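(* Let $\rho\in(0,\infty)$. The space of default solutions of the $\rho$-Brownian Boost ODE pair is equal to $$\Big\{\big(f_\rho(\xi,\bullet),g_\rho(\xi,\bullet)\big):\mathbb{R}\to(0,\infty)^2 \ :\ \xi\in(0,\infty)\Big\}.$$ For each $\xi\in(0,\infty)$, we have $g_\rho(\xi,\bullet)=f_\rho(\xi,\bullet)\,S_\rho(\xi,\bullet)$.
   Context: A pair of differentiable functions $f,g:\mathbb{R}\to(0,\infty)$ is a solution of the $\rho$-Brownian Boost ODE pair if at every point of $\mathbb{R}$ $$2\rho f^{1+\rho}g^\rho=(f^{2\rho}-g^{2\rho})f+\tfrac12f'(f^\rho+g^\rho)^2,$$ $$2\rho f^{\rho}g^{1+\rho}=-(f^{2\rho}-g^{2\rho})g-\tfrac12g'(f^\rho+g^\rho)^2.$$ The pair is called default if $f(0)=1$ and $g(0)>0$. For $\rho,\xi\in(0,\infty)$, $S_\rho(\xi,\bullet):\mathbb{R}\to(0,\infty)$ denotes the unique solution of $$\frac{d}{du}S_\rho(\xi,u)=-\frac{8\rho\,S_\rho(\xi,u)^{1+\rho}}{(1+S_\rho(\xi,u)^\rho)^2},\qquad S_\rho(\xi,0)=\xi.$$ Writing $S(r)=S_\rho(\xi,r)$, for $u\in\mathbb{R}$ set $$f_\rho(\xi,u)=\exp\Big\{2\int_0^u\Big(1-\frac{2\big(1+(1-\rho)S(r)^\rho\big)}{(1+S(r)^\rho)^2}\Big)dr\Big\},$$ $$g_\rho(\xi,u)=\xi\cdot\exp\Big\{-2\int_0^u\Big(1-\frac{2\big((1-\rho)S(r)^\rho+S(r)^{2\rho}\big)}{(1+S(r)^\rho)^2}\Big)dr\Big\},$$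 with the convention $\int_a^bh=-\int_b^ah$ for $a>b$. *)

theory Defs
  imports "HOL-Analysis.Analysis"
begin

text \<open>Functions into \<open>(0,\<infinity>)\<close> are represented as functions \<open>real \<Rightarrow> real\<close>
  with an explicit positivity condition.\<close>

definition boost_ode_solution :: "real \<Rightarrow> (real \<Rightarrow> real) \<Rightarrow> (real \<Rightarrow> real) \<Rightarrow> bool" where
  "boost_ode_solution \<rho> f g \<longleftrightarrow>
     (\<forall>x. 0 < f x) \<and> (\<forall>x. 0 < g x) \<and>
     (\<forall>x. f differentiable at x) \<and> (\<forall>x. g differentiable at x) \<and>
     (\<forall>x. 2 * \<rho> * f x powr (1 + \<rho>) * g x powr \<rho> =
            (f x powr (2 * \<rho>) - g x powr (2 * \<rho>)) * f x
              + 1 / 2 * deriv f x * (f x powr \<rho> + g x powr \<rho>)\<^sup>2) \<and>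
     (\<forall>x. 2 * \<rho> * f x powr \<rho> * g x powr (1 + \<rho>) =
            - (f x powr (2 * \<rho>) - g x powr (2 * \<rho>)) * g x
              - 1 / 2 * deriv g x * (f x powr \<rho> + g x powr \<rho>)\<^sup>2)"

definition default_boost_solution :: "real \<Rightarrow> (real \<Rightarrow> real) \<Rightarrow> (real \<Rightarrow> real) \<Rightarrow> bool" where
  "default_boost_solution \<rho> f g \<longleftrightarrow> boost_ode_solution \<rho> f g \<and> f 0 = 1 \<and> 0 < g 0"

definition is_S_solution :: "real \<Rightarrow> real \<Rightarrow> (real \<Rightarrow> real) \<Rightarrow> bool" where
  "is_S_solution \<rho> \<xi> s \<longleftrightarrow>
     (\<forall>u. 0 < s u) \<and> s 0 = \<xi> \<and>
     (\<forall>u. (s has_real_derivative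
            - (8 * \<rho> * s u powr (1 + \<rho>) / (1 + s u powr \<rho>)\<^sup>2)) (at u))"

definition boost_S :: "real \<Rightarrow> real \<Rightarrow> real \<Rightarrow> real" where
  "boost_S \<rho> \<xi> = (THE s. is_S_solution \<rho> \<xi> s)"

text \<open>The interval integral \<open>LBINT r=a..b. h r\<close> is by definition minus the integral
  from \<open>b\<close> to \<open>a\<close> when \<open>b < a\<close>.\<close>

definition boost_f :: "real \<Rightarrow> real \<Rightarrow> real \<Rightarrow> real" where
  "boost_f \<rho> \<xi> u =
     exp (2 * (LBINT r=ereal 0..ereal u.
       1 - 2 * (1 + (1 - \<rho>) * boost_S \<rho> \<xi> r powr \<rho>) / (1 + boost_S \<rho> \<xi> r powr \<rho>)\<^sup>2))"

definition boost_g :: "real \<Rightarrow> real \<Rightarrow> real \<Rightarrow> real" where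
  "boost_g \<rho> \<xi> u =
     \<xi> * exp (- 2 * (LBINT r=ereal 0..ereal u.
       1 - 2 * ((1 - \<rho>) * boost_S \<rho> \<xi> r powr \<rho> + boost_S \<rho> \<xi> r powr (2 * \<rho>))
             / (1 + boost_S \<rho> \<xi> r powr \<rho>)\<^sup>2))"

end

theory Submission
  imports Defs
begin

text \<open>The ratio \<open>s = g / f\<close> of a solution pair satisfies the autonomous scalar equation that defines
  \<open>S\<^sub>\<rho>\<close>, and \<open>f' / f\<close> and \<open>g' / g\<close> are functions of \<open>s\<close> alone. The scalar equation is separable:
  for \<open>x = \<rho> ln s\<close> it reads \<open>(1 + cosh x) x' = - 4 \<rho>\<^sup>2\<close>, so \<open>x + sinh x\<close> is affine in time. As
  \<open>x \<mapsto> x + sinh x\<close> is a diffeomorphism of the line, this gives global existence and uniqueness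
  of \<open>S\<^sub>\<rho>\<close>. Integrating the linear equations for \<open>f\<close> and \<open>g\<close> concludes.\<close>

section \<open>Integrals with a moving endpoint and linear scalar equations\<close>

lemma has_real_derivative_LBINT:
  fixes h :: "real \<Rightarrow> real"
  assumes h: "\<And>u. isCont h u"
  shows "((\<lambda>u. LBINT r=ereal a..ereal u. h r) has_real_derivative h u) (at u)"
proof -
  \<comment> \<open>The unit margins put \<open>u\<close> in the interior of the interval for either
    order of \<open>a\<close> and \<open>u\<close>, so the one-sided restriction on the derivative
    disappears.\<close>
  let ?a = "min a u - 1" and ?b = "max a u + 1"
  have "((\<lambda>u. LBINT r=ereal a..ereal u. h r) has_vector_derivative h u) (at u within {?a..?b})"
    by (rule interval_integral_FTC2) (auto intro!: h continuous_at_imp_continuous_on)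
  moreover have "at u within {?a..?b} = at u"
    by (rule at_within_Icc_at) auto
  ultimately show ?thesis
    by (simp add: has_real_derivative_iff_has_vector_derivative)
qed

lemma exp_LBINT_solves_linear_ode:
  fixes h :: "real \<Rightarrow> real"
  assumes h: "\<And>u. isCont h u"
  shows "((\<lambda>u. A * exp (c * (LBINT r=ereal a..ereal u. h r))) has_real_derivative
           c * h u * (A * exp (c * (LBINT r=ereal a..ereal u. h r)))) (at u)"
  by (rule derivative_eq_intros has_real_derivative_LBINT h refl | simp)+

text \<open>The quotient \<open>F / G\<close> has derivative zero, since the terms with
  \<open>k\<close> cancel; it is therefore constantly its value 1 at \<open>a\<close>.\<close>

lemma linear_ode_unique:
  fixes k F G :: "real \<Rightarrow> real"
  assumes F: "\<And>u. (F has_real_derivative k u * F u) (at u)"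
    and G: "\<And>u. (G has_real_derivative k u * G u) (at u)"
    and pos: "\<And>u. 0 < G u" and init: "F a = G a"
  shows "F = G"
proof
  fix u
  have "((\<lambda>u. F u / G u) has_real_derivative 0) (at u)" for u
    using pos[of u]
    by (auto intro!: derivative_eq_intros F G)
  then have "F u / G u = F a / G a"
    by (intro DERIV_isconst_all) auto
  then show "F u = G u"
    using pos[of u] pos[of a] init by simp
qed

section \<open>The diffeomorphism x + sinh x of the line\<close>

lemma DERIV_id_plus_sinh:
  "((\<lambda>x::real. x + sinh x) has_real_derivative 1 + cosh x) (at x)"
  by (auto intro!: derivative_eq_intros)

lemma id_plus_sinh_strict_mono: "strict_mono (\<lambda>x::real. x + sinh x)"
  by (auto intro!: strict_monoI add_strict_mono)

lemma id_plus_sinh_surj: "\<exists>x::real. x + sinh x = y"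
proof -
  have "\<exists>x\<ge>-\<bar>y\<bar>. x \<le> \<bar>y\<bar> \<and> x + sinh x = y"
  proof (rule IVT)
    \<comment> \<open>\<open>sinh\<close> has the sign of its argument, so adding it at the two
      endpoints only pushes the values further outwards.\<close>
    show "- \<bar>y\<bar> + sinh (- \<bar>y\<bar>) \<le> y" "y \<le> \<bar>y\<bar> + sinh \<bar>y\<bar>"
      using sinh_real_nonneg_iff[of "\<bar>y\<bar>"] by (auto simp del: sinh_real_nonneg_iff)
    show "\<forall>x. - \<bar>y\<bar> \<le> x \<and> x \<le> \<bar>y\<bar> \<longrightarrow> isCont (\<lambda>x. x + sinh x) x"
      using DERIV_isCont[OF DERIV_id_plus_sinh] by blast
  qed simp
  then show ?thesis by blast
qed

lemma id_plus_sinh_inverse: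
  obtains K :: "real \<Rightarrow> real" where
    "\<And>x. K (x + sinh x) = x"
    "\<And>y. (K has_real_derivative inverse (1 + cosh (K y))) (at y)"
proof -
  let ?P = "\<lambda>x::real. x + sinh x"
  have "\<forall>y. \<exists>x. ?P x = y"
    using id_plus_sinh_surj by blast
  then obtain K where PK: "\<And>y. ?P (K y) = y"
    by metis
  have KP: "K (?P x) = x" for x
    using strict_mono_eq[OF id_plus_sinh_strict_mono, of "K (?P x)" x] PK by simp
  \<comment> \<open>Continuity of the inverse comes at points of the form \<open>?P x\<close>;
    surjectivity makes these all of the line.\<close>
  have "isCont K (?P x)" for x
    by (rule isCont_inverse_function[where d = 1])
      (auto simp: KP intro: DERIV_isCont[OF DERIV_id_plus_sinh])
  then have cont: "isCont K y" for y
    using PK[of y] by metis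
  have "1 + cosh (K y) \<noteq> 0" for y
    using cosh_real_pos[of "K y"] by linarith
  then have "(K has_real_derivative inverse (1 + cosh (K y))) (at y)" for y
    by (intro DERIV_inverse_function[OF DERIV_id_plus_sinh _ _ _ PK cont, of _ "y - 1" "y + 1"]) auto
  then show thesis
    using that KP by blast
qed

section \<open>Existence and uniqueness for the scalar equation\<close>

text \<open>With t = s^\<rho> this is (1 + t)^2 = t (2 + t + 1/t), where t + 1/t is twice the
  \<open>cosh\<close> of ln t. It reduces the right-hand side of the equation for S to -4 \<rho> s /
  (1 + cosh (\<rho> ln s)).\<close>

lemma one_plus_powr_squared:
  fixes s \<rho> :: real
  assumes "0 < s"
  shows "(1 + s powr \<rho>)\<^sup>2 = 2 * s powr \<rho> * (1 + cosh (\<rho> * ln s))"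
  using assms
  by (simp add: powr_def cosh_field_def exp_minus power2_eq_square field_simps)

lemma is_S_solution_separated:
  assumes \<rho>: "0 < \<rho>" and s: "is_S_solution \<rho> \<xi> s"
  shows "\<rho> * ln (s u) + sinh (\<rho> * ln (s u))
       = \<rho> * ln \<xi> + sinh (\<rho> * ln \<xi>) - 4 * \<rho>\<^sup>2 * u"
proof -
  have pos: "0 < s u" and s0: "s 0 = \<xi>"
    and deriv: "(s has_real_derivative
      - (8 * \<rho> * s u powr (1 + \<rho>) / (1 + s u powr \<rho>)\<^sup>2)) (at u)" for u
    using s unfolding is_S_solution_def by blast+
  \<comment> \<open>A first integral: by the chain rule the factor \<open>C\<close> cancels the
    denominator in the derivative of \<rho> ln s.\<close>
  let ?Q = "\<lambda>u. \<rho> * ln (s u) + sinh (\<rho> * ln (s u)) + 4 * \<rho>\<^sup>2 * u"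
  have "(?Q has_real_derivative 0) (at u)" for u
  proof -
    define C where "C = 1 + cosh (\<rho> * ln (s u))"
    have C: "C > 0" using cosh_real_pos[of "\<rho> * ln (s u)"] unfolding C_def by linarith
    have p: "s u powr \<rho> > 0" using pos[of u] by simp
    have eq: "- (8 * \<rho> * s u powr (1 + \<rho>) / (1 + s u powr \<rho>)\<^sup>2) = - (4 * \<rho> * s u / C)"
      using pos[of u] p C by (simp add: one_plus_powr_squared C_def[symmetric] powr_add)
    have d: "(s has_real_derivative - (4 * \<rho> * s u / C)) (at u)"
      using deriv[of u] unfolding eq .
    have "((\<lambda>u. \<rho> * ln (s u)) has_real_derivative - (4 * \<rho>\<^sup>2 / C)) (at u)"
      by (rule derivative_eq_intros d refl | use pos[of u] C in \<open>simp add: field_simps power2_eq_square\<close>)+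
    from DERIV_chain2[OF DERIV_id_plus_sinh this]
    have "((\<lambda>u. \<rho> * ln (s u) + sinh (\<rho> * ln (s u))) has_real_derivative
        C * - (4 * \<rho>\<^sup>2 / C)) (at u)"
      unfolding C_def .
    from DERIV_add[OF this DERIV_cmult[OF DERIV_ident, of "4 * \<rho>\<^sup>2"]]
    show ?thesis using C by simp
  qed
  then have "?Q u = ?Q 0"
    by (intro DERIV_isconst_all) auto
  then show ?thesis using s0 by simp
qed

lemma is_S_solution_unique:
  assumes "0 < \<rho>" "is_S_solution \<rho> \<xi> s" "is_S_solution \<rho> \<xi> s'"
  shows "s = s'"
proof
  fix u
  have "\<rho> * ln (s u) = \<rho> * ln (s' u)"
    using is_S_solution_separated[OF assms(1,2), of u] is_S_solution_separated[OF assms(1,3), of u]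
      strict_mono_eq[OF id_plus_sinh_strict_mono, of "\<rho> * ln (s u)" "\<rho> * ln (s' u)"] by simp
  then show "s u = s' u"
    using assms by (simp add: is_S_solution_def)
qed

lemma is_S_solution_exists:
  assumes \<rho>: "0 < \<rho>" and \<xi>: "0 < \<xi>"
  shows "\<exists>s. is_S_solution \<rho> \<xi> s"
proof -
  obtain K :: "real \<Rightarrow> real" where KP: "\<And>x. K (x + sinh x) = x"
    and K: "\<And>y. (K has_real_derivative inverse (1 + cosh (K y))) (at y)"
    using id_plus_sinh_inverse by blast
  \<comment> \<open>\<open>y u\<close> is the value that separation of variables forces on x + sinh
    x at time \<open>u\<close>, with x = \<rho> ln s. Applying \<open>K\<close> recovers x, and s =
    exp (x / \<rho>).\<close>
  define y where "y u = \<rho> * ln \<xi> + sinh (\<rho> * ln \<xi>) - 4 * \<rho>\<^sup>2 * u" for u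
  define s where "s u = exp (K (y u) / \<rho>)" for u
  have y: "(y has_real_derivative - 4 * \<rho>\<^sup>2) (at u)" for u
    unfolding y_def by (auto intro!: derivative_eq_intros)
  have "(s has_real_derivative - (8 * \<rho> * s u powr (1 + \<rho>) / (1 + s u powr \<rho>)\<^sup>2)) (at u)" for u
  proof -
    have pos: "s u > 0" and ln_s: "\<rho> * ln (s u) = K (y u)"
      using \<rho> by (auto simp: s_def)
    have C: "1 + cosh (K (y u)) > 0"
      using cosh_real_pos[of "K (y u)"] by linarith
    have p: "s u powr \<rho> > 0" using pos by simp
    have "(s has_real_derivative
        s u * (inverse (1 + cosh (K (y u))) * (- 4 * \<rho>\<^sup>2) / \<rho>)) (at u)"
      unfolding s_def by (rule DERIV_fun_exp[OF DERIV_cdivide[OF DERIV_chain2[OF K y]]])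
    moreover have "s u * (inverse (1 + cosh (K (y u))) * (- 4 * \<rho>\<^sup>2) / \<rho>)
        = - (8 * \<rho> * s u powr (1 + \<rho>) / (1 + s u powr \<rho>)\<^sup>2)"
      using pos C \<rho> p unfolding one_plus_powr_squared[OF pos] ln_s powr_add
      by (simp add: divide_simps power2_eq_square)
    ultimately show ?thesis by metis
  qed
  moreover have "s 0 = \<xi>"
    using \<rho> \<xi> by (simp add: s_def y_def KP)
  ultimately have "is_S_solution \<rho> \<xi> s"
    by (simp add: is_S_solution_def s_def)
  then show ?thesis by blast
qed

text \<open>Uniqueness resolves the definite description. Allowing any solution \<open>s\<close>
  lets the ratio of an arbitrary default pair be recognised as \<open>boost_S\<close>.\<close>

lemma boost_S_eqI:
  assumes "0 < \<rho>" "is_S_solution \<rho> \<xi> s"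
  shows "boost_S \<rho> \<xi> = s"
  unfolding boost_S_def
  by (rule the_equality) (use assms is_S_solution_unique in blast)+

lemma boost_S_is_S_solution:
  assumes "0 < \<rho>" "0 < \<xi>"
  shows "is_S_solution \<rho> \<xi> (boost_S \<rho> \<xi>)"
  using is_S_solution_exists[OF assms] boost_S_eqI assms(1) by metis

text \<open>The logarithmic derivatives of \<open>f\<close> and \<open>g\<close> in terms of \<open>s = g / f\<close>.\<close>

definition rate_f :: "real \<Rightarrow> real \<Rightarrow> real" where
  "rate_f \<rho> s = 2 * (s powr (2 * \<rho>) - 1 + 2 * \<rho> * s powr \<rho>) / (1 + s powr \<rho>)\<^sup>2"

definition rate_g :: "real \<Rightarrow> real \<Rightarrow> real" where
  "rate_g \<rho> s = 2 * (s powr (2 * \<rho>) - 1 - 2 * \<rho> * s powr \<rho>) / (1 + s powr \<rho>)\<^sup>2"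

lemma powr_double: "(s::real) powr (2 * \<rho>) = (s powr \<rho>)\<^sup>2"
  by (metis mult_2 power2_eq_square powr_add)

lemma one_plus_powr_pos: "0 < 1 + (s::real) powr \<rho>"
  by (rule add_pos_nonneg) auto

text \<open>Matches the rate with the integrand of \<open>boost_f\<close>: for t = s^\<rho>, (1 +
  t)^2 - 2 (1 + (1 - \<rho>) t) = t^2 - 1 + 2 \<rho> t.\<close>

lemma rate_f_eq: "rate_f \<rho> s = 2 * (1 - 2 * (1 + (1 - \<rho>) * s powr \<rho>) / (1 + s powr \<rho>)\<^sup>2)"
  using one_plus_powr_pos[of s \<rho>]
  unfolding rate_f_def powr_double by (simp add: field_simps) (simp add: power2_eq_square algebra_simps)

lemma rate_g_eq:
  "rate_g \<rho> s = - 2 * (1 - 2 * ((1 - \<rho>) * s powr \<rho> + s powr (2 * \<rho>)) / (1 + s powr \<rho>)\<^sup>2)"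
  using one_plus_powr_pos[of s \<rho>]
  unfolding rate_g_def powr_double by (simp add: field_simps) (simp add: power2_eq_square algebra_simps)

text \<open>The difference of rates is the logarithmic derivative of g / f, so this identity says
  that the ratio obeys the equation for S.\<close>

lemma rate_g_minus_rate_f:
  "0 < s \<Longrightarrow> (rate_g \<rho> s - rate_f \<rho> s) * s
     = - (8 * \<rho> * s powr (1 + \<rho>) / (1 + s powr \<rho>)\<^sup>2)"
  using one_plus_powr_pos[of s \<rho>]
  by (simp add: rate_f_def rate_g_def powr_add field_simps)

section \<open>The explicit pair: derivatives, initial values and ratio\<close>

lemma boost_S_pos:
  assumes "0 < \<rho>" "0 < \<xi>"
  shows "0 < boost_S \<rho> \<xi> u"
  using boost_S_is_S_solution[OF assms] by (simp add: is_S_solution_def)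

lemma DERIV_boost_S:
  assumes "0 < \<rho>" "0 < \<xi>"
  shows "(boost_S \<rho> \<xi> has_real_derivative
    (rate_g \<rho> (boost_S \<rho> \<xi> u) - rate_f \<rho> (boost_S \<rho> \<xi> u)) * boost_S \<rho> \<xi> u) (at u)"
  using boost_S_is_S_solution[OF assms] boost_S_pos[OF assms]
  by (simp add: rate_g_minus_rate_f is_S_solution_def)

lemma isCont_boost_S_powr:
  assumes "0 < \<rho>" "0 < \<xi>"
  shows "isCont (\<lambda>u. boost_S \<rho> \<xi> u powr a) u"
  using DERIV_isCont[OF DERIV_boost_S[OF assms, of u]] boost_S_pos[OF assms, of u]
  by (intro continuous_intros) auto

lemma DERIV_boost_f:
  assumes "0 < \<rho>" "0 < \<xi>"
  shows "(boost_f \<rho> \<xi> has_real_derivative rate_f \<rho> (boost_S \<rho> \<xi> u) * boost_f \<rho> \<xi> u) (at u)"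
proof -
  have "isCont (\<lambda>r. 1 - 2 * (1 + (1 - \<rho>) * boost_S \<rho> \<xi> r powr \<rho>)
      / (1 + boost_S \<rho> \<xi> r powr \<rho>)\<^sup>2) u" for u
    using one_plus_powr_pos[of "boost_S \<rho> \<xi> u" \<rho>]
    by (intro continuous_intros isCont_boost_S_powr assms) auto
  from exp_LBINT_solves_linear_ode[OF this, where A = 1 and c = 2 and a = 0 and u = u]
  show ?thesis
    unfolding boost_f_def[abs_def] rate_f_eq mult_1 .
qed

lemma DERIV_boost_g:
  assumes "0 < \<rho>" "0 < \<xi>"
  shows "(boost_g \<rho> \<xi> has_real_derivative rate_g \<rho> (boost_S \<rho> \<xi> u) * boost_g \<rho> \<xi> u) (at u)"
proof -
  have "isCont (\<lambda>r. 1 - 2 * ((1 - \<rho>) * boost_S \<rho> \<xi> r powr \<rho> + boost_S \<rho> \<xi> r powr (2 * \<rho>))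
      / (1 + boost_S \<rho> \<xi> r powr \<rho>)\<^sup>2) u" for u
    using one_plus_powr_pos[of "boost_S \<rho> \<xi> u" \<rho>]
    by (intro continuous_intros isCont_boost_S_powr assms) auto
  from exp_LBINT_solves_linear_ode[OF this, where A = \<xi> and c = "-2" and a = 0 and u = u]
  show ?thesis
    unfolding boost_g_def[abs_def] rate_g_eq .
qed

lemma boost_f_pos: "0 < boost_f \<rho> \<xi> u"
  by (simp add: boost_f_def)

lemma boost_g_pos: "0 < \<xi> \<Longrightarrow> 0 < boost_g \<rho> \<xi> u"
  by (simp add: boost_g_def)

lemma boost_f_0: "boost_f \<rho> \<xi> 0 = 1"
  by (simp add: boost_f_def)

lemma boost_g_0: "boost_g \<rho> \<xi> 0 = \<xi>"
  by (simp add: boost_g_def)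

text \<open>Both sides solve the same linear equation with value \<xi> at 0: in the product rule the
  rates \<open>rate_f\<close> and \<open>rate_g - rate_f\<close> add up to
  \<open>rate_g\<close>.\<close>

lemma boost_g_eq_boost_f_mult_boost_S:
  assumes "0 < \<rho>" "0 < \<xi>"
  shows "boost_g \<rho> \<xi> = (\<lambda>u. boost_f \<rho> \<xi> u * boost_S \<rho> \<xi> u)"
proof (rule linear_ode_unique[where a = 0])
  show "(boost_g \<rho> \<xi> has_real_derivative rate_g \<rho> (boost_S \<rho> \<xi> u) * boost_g \<rho> \<xi> u) (at u)" for u
    by (rule DERIV_boost_g[OF assms])
  show "((\<lambda>u. boost_f \<rho> \<xi> u * boost_S \<rho> \<xi> u) has_real_derivative
      rate_g \<rho> (boost_S \<rho> \<xi> u) * (boost_f \<rho> \<xi> u * boost_S \<rho> \<xi> u)) (at u)" for u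
    by (rule derivative_eq_intros DERIV_boost_f DERIV_boost_S assms refl
        | simp add: algebra_simps)+
  show "0 < boost_f \<rho> \<xi> u * boost_S \<rho> \<xi> u" for u
    by (simp add: boost_f_pos boost_S_pos assms)
  show "boost_g \<rho> \<xi> 0 = boost_f \<rho> \<xi> 0 * boost_S \<rho> \<xi> 0"
    using boost_S_is_S_solution[OF assms] by (simp add: boost_g_0 boost_f_0 is_S_solution_def)
qed

section \<open>The ODE pair in logarithmic-derivative form\<close>

text \<open>The rates are homogeneous of degree zero in (x^\<rho>, y^\<rho>): numerator and
  denominator are multiplied by x^(2 \<rho>).\<close>

lemma rate_ratio:
  fixes x y \<rho> :: real
  assumes x: "0 < x" and y: "0 < y"
  shows "rate_f \<rho> (y / x) = 2 * ((y powr \<rho>)\<^sup>2 - (x powr \<rho>)\<^sup>2 + 2 * \<rho> * x powr \<rho> * y powr \<rho>)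
           / (x powr \<rho> + y powr \<rho>)\<^sup>2"
    and "rate_g \<rho> (y / x) = 2 * ((y powr \<rho>)\<^sup>2 - (x powr \<rho>)\<^sup>2 - 2 * \<rho> * x powr \<rho> * y powr \<rho>)
           / (x powr \<rho> + y powr \<rho>)\<^sup>2"
proof -
  define a b where "a = x powr \<rho>" and "b = y powr \<rho>"
  have a: "0 < a" and b: "0 < b" using x y by (auto simp: a_def b_def)
  have r: "(y / x) powr \<rho> = b / a"
    using x y by (simp add: a_def b_def powr_divide)
  have 1: "1 + b / a = (a + b) / a"
    using a by (simp add: field_simps)
  \<comment> \<open>One identity serves both rates, with c = 2 \<rho> and c = -2 \<rho>.\<close>
  have "2 * ((b / a)\<^sup>2 - 1 + c * (b / a)) / ((a + b) / a)\<^sup>2 = 2 * (b\<^sup>2 - a\<^sup>2 + c * a * b) / (a + b)\<^sup>2" for c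
  proof -
    have "2 * ((b / a)\<^sup>2 - 1 + c * (b / a)) = 2 * (b\<^sup>2 - a\<^sup>2 + c * a * b) / a\<^sup>2"
      using a by (simp add: field_simps power2_eq_square)
    then show ?thesis
      using a b by (simp add: power_divide)
  qed
  from this[of "2 * \<rho>"] this[of "- 2 * \<rho>"]
  show "rate_f \<rho> (y / x) = 2 * ((y powr \<rho>)\<^sup>2 - (x powr \<rho>)\<^sup>2 + 2 * \<rho> * x powr \<rho> * y powr \<rho>)
           / (x powr \<rho> + y powr \<rho>)\<^sup>2"
    and "rate_g \<rho> (y / x) = 2 * ((y powr \<rho>)\<^sup>2 - (x powr \<rho>)\<^sup>2 - 2 * \<rho> * x powr \<rho> * y powr \<rho>)
           / (x powr \<rho> + y powr \<rho>)\<^sup>2"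
    unfolding rate_f_def rate_g_def powr_double r 1 by (simp_all add: a_def b_def)
qed

text \<open>Each equation is affine in the derivative, with a nonzero coefficient, and can be solved
  for it. The reals \<open>d\<close> and \<open>e\<close> stand for the derivatives at one
  point.\<close>

lemma boost_ode_iff:
  fixes x y d e \<rho> :: real
  assumes x: "0 < x" and y: "0 < y"
  shows "2 * \<rho> * x powr (1 + \<rho>) * y powr \<rho>
      = (x powr (2 * \<rho>) - y powr (2 * \<rho>)) * x + 1 / 2 * d * (x powr \<rho> + y powr \<rho>)\<^sup>2
    \<longleftrightarrow> d = rate_f \<rho> (y / x) * x"
    and "2 * \<rho> * x powr \<rho> * y powr (1 + \<rho>)
      = - (x powr (2 * \<rho>) - y powr (2 * \<rho>)) * y - 1 / 2 * e * (x powr \<rho> + y powr \<rho>)\<^sup>2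
    \<longleftrightarrow> e = rate_g \<rho> (y / x) * y"
proof -
  have D: "(x powr \<rho> + y powr \<rho>)\<^sup>2 \<noteq> 0"
    using x y by (simp add: add_nonneg_eq_0_iff)
  show "2 * \<rho> * x powr (1 + \<rho>) * y powr \<rho>
      = (x powr (2 * \<rho>) - y powr (2 * \<rho>)) * x + 1 / 2 * d * (x powr \<rho> + y powr \<rho>)\<^sup>2
    \<longleftrightarrow> d = rate_f \<rho> (y / x) * x"
    using x D unfolding rate_ratio[OF x y] powr_double powr_add
    by (simp add: eq_divide_eq) (auto simp: algebra_simps)
  show "2 * \<rho> * x powr \<rho> * y powr (1 + \<rho>)
      = - (x powr (2 * \<rho>) - y powr (2 * \<rho>)) * y - 1 / 2 * e * (x powr \<rho> + y powr \<rho>)\<^sup>2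
    \<longleftrightarrow> e = rate_g \<rho> (y / x) * y"
    using y D unfolding rate_ratio[OF x y] powr_double powr_add
    by (simp add: eq_divide_eq) (auto simp: algebra_simps)
qed

lemma boost_ode_solution_iff:
  "boost_ode_solution \<rho> f g \<longleftrightarrow>
     (\<forall>x. 0 < f x) \<and> (\<forall>x. 0 < g x) \<and>
     (\<forall>x. (f has_real_derivative rate_f \<rho> (g x / f x) * f x) (at x)) \<and>
     (\<forall>x. (g has_real_derivative rate_g \<rho> (g x / f x) * g x) (at x))"
proof -
  \<comment> \<open>\<open>deriv\<close> carries information only where the function is
    differentiable, so the two conjuncts are merged into one.\<close>
  have *: "(F has_real_derivative D) (at x) \<longleftrightarrow> F differentiable at x \<and> deriv F x = D"
    for F :: "real \<Rightarrow> real" and D x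
    by (metis DERIV_imp_deriv DERIV_deriv_iff_real_differentiable)
  show ?thesis
    unfolding * boost_ode_solution_def
    using boost_ode_iff by auto
qed

theorem theorem1p15:
  fixes \<rho> :: real
  assumes "0 < \<rho>"
  shows "{(f, g). default_boost_solution \<rho> f g} = {(boost_f \<rho> \<xi>, boost_g \<rho> \<xi>) | \<xi>. 0 < \<xi>}
    \<and> (\<forall>\<xi>. 0 < \<xi> \<longrightarrow> boost_g \<rho> \<xi> = (\<lambda>u. boost_f \<rho> \<xi> u * boost_S \<rho> \<xi> u))"
proof -
  have sol: "default_boost_solution \<rho> (boost_f \<rho> \<xi>) (boost_g \<rho> \<xi>)" if \<xi>: "0 < \<xi>" for \<xi>
  proof -
    have "boost_g \<rho> \<xi> x / boost_f \<rho> \<xi> x = boost_S \<rho> \<xi> x" for x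
      using boost_f_pos[of \<rho> \<xi> x] by (simp add: boost_g_eq_boost_f_mult_boost_S[OF assms \<xi>])
    then show ?thesis
      using assms \<xi>
      by (simp add: default_boost_solution_def boost_ode_solution_iff boost_f_pos boost_g_pos
          boost_f_0 boost_g_0 DERIV_boost_f DERIV_boost_g)
  qed
  \<comment> \<open>The parameter is forced to be \<open>g 0\<close>, the initial value of the
    second component.\<close>
  have uniq: "f = boost_f \<rho> (g 0) \<and> g = boost_g \<rho> (g 0)"
    if fg: "default_boost_solution \<rho> f g" for f g
  proof -
    have f0: "f 0 = 1" and g0: "0 < g 0" and fpos: "\<And>x. 0 < f x" and gpos: "\<And>x. 0 < g x"
      and f': "\<And>x. (f has_real_derivative rate_f \<rho> (g x / f x) * f x) (at x)"
      and g': "\<And>x. (g has_real_derivative rate_g \<rho> (g x / f x) * g x) (at x)"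
      using fg unfolding default_boost_solution_def boost_ode_solution_iff by auto
    have "((\<lambda>x. g x / f x) has_real_derivative
        (rate_g \<rho> (g x / f x) - rate_f \<rho> (g x / f x)) * (g x / f x)) (at x)" for x
      using fpos[of x]
      by (auto intro!: derivative_eq_intros f' g' simp: field_simps)
    \<comment> \<open>The normalisation f(0) = 1 makes the ratio start at
      \<open>g 0\<close>.\<close>
    then have "is_S_solution \<rho> (g 0) (\<lambda>x. g x / f x)"
      unfolding is_S_solution_def using fpos gpos f0
      by (simp add: rate_g_minus_rate_f del: times_divide_eq_left times_divide_eq_right)
    then have S: "boost_S \<rho> (g 0) = (\<lambda>x. g x / f x)"
      by (rule boost_S_eqI[OF assms])
    \<comment> \<open>With the ratio identified, the system decouples: \<open>f\<close> and
      \<open>boost_f\<close> solve one linear equation with a known coefficient and the same initial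
      value. The same works for \<open>g\<close>.\<close>
    have "f = boost_f \<rho> (g 0)"
      using f' DERIV_boost_f[OF assms g0] boost_f_pos f0 boost_f_0
      unfolding S by (intro linear_ode_unique[where a = 0]) auto
    moreover have "g = boost_g \<rho> (g 0)"
      using g' DERIV_boost_g[OF assms g0] boost_g_pos[OF g0] boost_g_0
      unfolding S by (intro linear_ode_unique[where a = 0]) auto
    ultimately show ?thesis by blast
  qed
  have "0 < g 0" if "default_boost_solution \<rho> f g" for f g
    using that by (simp add: default_boost_solution_def)
  then show ?thesis
    using sol uniq boost_g_eq_boost_f_mult_boost_S[OF assms] by blast
qed

end
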